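(* Let $\mathbb{K}$ be a finite field and $u \in \mathbb{K}^{*}$. Let $m$ be the size of the $u$-trinomial minimal solution of $(E_{\mathbb{K}})$ and let $o(u)$ be the order of $u$ in the group $\mathbb{K}^{*}$. Then: - if $\mathrm{char}(\mathbb{K})=2$, then $m=3o(u)$; - if $\mathrm{char}(\mathbb{K})\neq 2$ and $o(u)$ is even, then $m=\frac{3o(u)}{2}$; - if $\mathrm{char}(\mathbb{K})\neq 2$ and $o(u)$ is odd, then $m=3o(u)$. Moreover, if $u \notin \{1_{\mathbb{K}},-1_{\mathbb{K}}\}$, the $u$-trinomial minimal solution of $(E_{\mathbb{K}})$ is irreducible if and only if $u$ is a root of neither of the polynomials $X^{2l}+X^{l+1}-1_{\mathbb{K}}$ and $X^{2l}-X^{l+1}-1_{\mathbb{K}}$ for any integer $l$ with $1 \leq l \leq \lfloor m/6 \rfloor$.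
   Context: Let $A$ be a commutative unital ring ($0_A\neq 1_A$). For $a_1,\ldots,a_n\in A$ set $M_n(a_1,\ldots,a_n)=\begin{pmatrix} a_n & -1_A\\ 1_A & 0_A\end{pmatrix}\cdots\begin{pmatrix} a_1 & -1_A\\ 1_A & 0_A\end{pmatrix}$. An $n$-tuple $(a_1,\ldots,a_n)\in A^n$ is a solution of $(E_A)$ (a $\lambda$-quiddity) if $M_n(a_1,\ldots,a_n)=\pm \mathrm{Id}$. For tuples, $(a_1,\ldots,a_n)\oplus(b_1,\ldots,b_m)=(a_1+b_m,a_2,\ldots,a_{n-1},a_n+b_1,b_2,\ldots,b_{m-1})$. Write $(a_1,\ldots,a_n)\sim(b_1,\ldots,b_n)$ if $(b_1,\ldots,b_n)$ is obtained from $(a_1,\ldots,a_n)$ or from $(a_n,\ldots,a_1)$ by a cyclic permutation. A solution $(c_1,\ldots,c_n)$ of $(E_A)$ with $n\geq 3$ is reducible if there exist a solution $(b_1,\ldots,b_l)$ of $(E_A)$ and an $m$-tuple $(a_1,\ldots,a_m)$ of elements of $A$ with $l\geq 3$, $m\geq 3$ and $(c_1,\ldots,c_n)\sim(a_1,\ldots,a_m)\oplus(b_1,\ldots,b_l)$; it is irreducible otherwise. For $A$ finite and $u$ a unit of $A$, the $u$-trinomial minimal solution of $(E_A)$ is the solution of $(E_A)$ of the form $(u,u^{-1},u^{-1},u,u^{-1},u^{-1},\ldots,u,u^{-1},u^{-1})$ (the block $(u,u^{-1},u^{-1})$ repeated $k\geq 1$ times) of minimal size; it exists. *)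

theory Defs
  imports
    "HOL-Analysis.Analysis"
    "HOL-Computational_Algebra.Computational_Algebra"
begin

text \<open>
  Tuples \<open>(a\<^sub>1, \<dots>, a\<^sub>n)\<close> are lists.  The product is ordered with the factor of \<open>a\<^sub>1\<close>
  rightmost: \<open>quiddity_matrix [a\<^sub>1, \<dots>, a\<^sub>n] = E(a\<^sub>n) \<cdots> E(a\<^sub>1)\<close>, where \<open>E = elem_matrix\<close>.
\<close>

definition elem_matrix :: "'a::comm_ring_1 \<Rightarrow> 'a^2^2" where
  "elem_matrix a = vector [vector [a, -1], vector [1, 0]]"

primrec quiddity_matrix :: "'a::comm_ring_1 list \<Rightarrow> 'a^2^2" where
  "quiddity_matrix [] = mat 1"
| "quiddity_matrix (a # as) = quiddity_matrix as ** elem_matrix a"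

text \<open>The empty list satisfies the next predicate, but below it is only applied to nonempty ones.\<close>

definition quiddity_solution :: "'a::comm_ring_1 list \<Rightarrow> bool" where
  "quiddity_solution as \<longleftrightarrow> quiddity_matrix as = mat 1 \<or> quiddity_matrix as = - mat 1"

text \<open>
  \<open>(a\<^sub>1 + b\<^sub>m, a\<^sub>2, \<dots>, a\<^bsub>n-1\<^esub>, a\<^sub>n + b\<^sub>1, b\<^sub>2, \<dots>, b\<^bsub>m-1\<^esub>)\<close>; meaningful for tuples of size at least 2.
\<close>

definition tuple_sum :: "'a::comm_ring_1 list \<Rightarrow> 'a list \<Rightarrow> 'a list" where
  "tuple_sum as bs =
     (hd as + last bs) # butlast (tl as) @ (last as + hd bs) # butlast (tl bs)"

definition tuple_equiv :: "'a list \<Rightarrow> 'a list \<Rightarrow> bool" where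
  "tuple_equiv as bs \<longleftrightarrow> (\<exists>k. bs = rotate k as \<or> bs = rotate k (rev as))"

text \<open>Only the second summand \<open>bs\<close> is required to be a solution.\<close>

definition reducible_solution :: "'a::comm_ring_1 list \<Rightarrow> bool" where
  "reducible_solution cs \<longleftrightarrow>
     quiddity_solution cs \<and> length cs \<ge> 3 \<and>
     (\<exists>as bs. quiddity_solution bs \<and> length bs \<ge> 3 \<and> length as \<ge> 3 \<and>
              tuple_equiv cs (tuple_sum as bs))"

definition irreducible_solution :: "'a::comm_ring_1 list \<Rightarrow> bool" where
  "irreducible_solution cs \<longleftrightarrow>
     quiddity_solution cs \<and> length cs \<ge> 3 \<and> \<not> reducible_solution cs"

definition trinomial_tuple :: "'a::field \<Rightarrow> nat \<Rightarrow> 'a list" where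
  "trinomial_tuple u k = concat (replicate k [u, inverse u, inverse u])"

text \<open>
  Over a finite field and for \<open>u \<noteq> 0\<close> some \<open>k \<ge> 1\<close> yields a solution (invertible
  matrices then have finite order), so the \<open>LEAST\<close> below is attained.
\<close>

definition trinomial_minimal_solution :: "'a::field \<Rightarrow> 'a list" where
  "trinomial_minimal_solution u =
     trinomial_tuple u (LEAST k. k \<ge> 1 \<and> quiddity_solution (trinomial_tuple u k))"

text \<open>
  Order in the group of units; the library's \<open>group.ord\<close> would need a carrier-based group,
  whereas the field here is a type.  For \<open>u \<noteq> 0\<close> in a finite field the \<open>LEAST\<close> is attained.
\<close>

definition unit_order :: "'a::field \<Rightarrow> nat" where
  "unit_order u = (LEAST n. n \<ge> 1 \<and> u ^ n = 1)"

end

theory Submission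
  imports Defs
begin

unbundle no fps_syntax

text \<open>
  Write \<open>v = u\<^sup>-\<^sup>1\<close>.  The block \<open>(u, v, v)\<close> has a triangular matrix with diagonal \<open>(-u, -v)\<close>, and
  its \<open>k\<close>-th power is \<open>\<plusminus>Id\<close> iff \<open>u\<^sup>k = \<plusminus>1\<close>; this gives the size \<open>m = 3k\<close>.

  A solution is reducible iff some cyclic factor of length between \<open>1\<close> and \<open>m - 3\<close> has a matrix
  with upper left entry \<open>\<plusminus>1\<close>.  For the trinomial solution this entry is, up to sign, \<open>0\<close>, a power
  \<open>u\<^sup>j\<close> or \<open>v\<^sup>j\<close> with \<open>0 < j < k\<close>, or, for the factors starting and ending with \<open>v, v\<close>, the
  difference \<open>u\<^bsup>l-1\<^esup> - v\<^bsup>l+1\<^esup>\<close> with \<open>0 < l < k\<close>.  The last one is \<open>\<plusminus>1\<close> iff \<open>u\<^sup>l - v\<^sup>l = \<plusminus>u\<close>, a condition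
  which \<open>u\<^sup>k = \<plusminus>1\<close> makes invariant under \<open>l \<mapsto> k - l\<close>, so \<open>l \<le> k/2\<close> suffices.
\<close>

section \<open>Explicit two-by-two matrices\<close>

definition mat2 :: "'a \<Rightarrow> 'a \<Rightarrow> 'a \<Rightarrow> 'a \<Rightarrow> 'a::comm_ring_1^2^2" where
  "mat2 a b c d = vector [vector [a, b], vector [c, d]]"

lemma mat2_nth [simp]:
  "mat2 a b c d $ 1 $ 1 = a" "mat2 a b c d $ 1 $ 2 = b"
  "mat2 a b c d $ 2 $ 1 = c" "mat2 a b c d $ 2 $ 2 = d"
  by (simp_all add: mat2_def)

lemma mat2_eta: "A = mat2 (A $ 1 $ 1) (A $ 1 $ 2) (A $ 2 $ 1) (A $ 2 $ 2)"
  by (simp add: vec_eq_iff forall_2)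

lemma mat2_eq_iff [simp]:
  "mat2 a b c d = mat2 a' b' c' d' \<longleftrightarrow> a = a' \<and> b = b' \<and> c = c' \<and> d = d'"
  by (auto simp: vec_eq_iff forall_2)

lemma mat2_mult [simp]:
  "mat2 a b c d ** mat2 a' b' c' d' =
    mat2 (a * a' + b * c') (a * b' + b * d') (c * a' + d * c') (c * b' + d * d')"
  by (simp add: vec_eq_iff forall_2 matrix_matrix_mult_def sum_2)

lemma det_mat2 [simp]: "det (mat2 a b c d) = a * d - b * c"
  by (simp add: det_2)

lemma mat_1_eq_mat2: "mat 1 = mat2 1 0 0 1"
  by (simp add: vec_eq_iff forall_2 mat_def)

lemma uminus_mat_1_eq_mat2: "- mat 1 = mat2 (- 1) 0 0 (- 1)"
  by (simp add: vec_eq_iff forall_2 mat_def)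

lemma elem_matrix_eq_mat2: "elem_matrix a = mat2 a (- 1) 1 0"
  by (simp add: elem_matrix_def mat2_def)

section \<open>Extending a tuple to a solution, and reducibility in terms of factors\<close>

lemma quiddity_solution_iff_mat2:
  "quiddity_solution xs \<longleftrightarrow>
    quiddity_matrix xs = mat2 1 0 0 1 \<or> quiddity_matrix xs = mat2 (- 1) 0 0 (- 1)"
  by (simp only: quiddity_solution_def uminus_mat_1_eq_mat2) (simp only: mat_1_eq_mat2)

lemma quiddity_matrix_append:
  "quiddity_matrix (xs @ ys) = quiddity_matrix ys ** quiddity_matrix xs"
  by (induction xs) (simp_all add: matrix_mul_assoc)

lemma det_quiddity_matrix: "det (quiddity_matrix xs) = 1"
  by (induction xs) (simp_all add: det_mul elem_matrix_eq_mat2)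

text \<open>Bordering \<open>ys\<close> by \<open>a\<close> and \<open>b\<close> puts
  \<open>- p\<close> in the lower right corner, where \<open>p\<close> is the upper left entry of
  the matrix of \<open>ys\<close>; hence \<open>p\<close> must be \<plusminus>1. Conversely, such a
  \<open>p\<close> is invertible, so \<open>a\<close> and \<open>b\<close> can clear the
  off-diagonal entries, and determinant one fixes the last entry.\<close>

lemma ex_solution_extending_iff:
  "(\<exists>a b. quiddity_solution (a # ys @ [b])) \<longleftrightarrow> quiddity_matrix ys $ 1 $ 1 \<in> {1, - 1}"
proof -
  define p q r s where pqrs: "p = quiddity_matrix ys $ 1 $ 1" "q = quiddity_matrix ys $ 1 $ 2"
    "r = quiddity_matrix ys $ 2 $ 1" "s = quiddity_matrix ys $ 2 $ 2"
  have X: "quiddity_matrix ys = mat2 p q r s"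
    unfolding pqrs by (rule mat2_eta)
  have det: "p * s - q * r = 1"
    using det_quiddity_matrix[of ys] by (simp add: X)
  have M: "quiddity_matrix (a # ys @ [b]) =
      mat2 (b * (p * a + q) - (r * a + s)) (r - b * p) (p * a + q) (- p)" for a b
    by (simp add: quiddity_matrix_append X elem_matrix_eq_mat2 mat_1_eq_mat2 algebra_simps)
  have "\<exists>a b. quiddity_solution (a # ys @ [b])" if "p = 1 \<or> p = - 1"
  proof -
    have "p * s = 1 + q * r"
      using det by (simp add: diff_eq_eq)
    moreover have "s = p * (p * s)"
      using that by auto
    ultimately have "s = p * (1 + q * r)"
      by metis
    \<comment> \<open>The witnesses solve \<open>p * a + q = 0\<close> and
      \<open>r - b * p = 0\<close>, by \<open>p * p = 1\<close>. Both diagonal entries then equal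
      \<open>- p\<close>.\<close>
    then have "quiddity_solution ((- q * p) # ys @ [r * p])"
      using that unfolding quiddity_solution_iff_mat2 M by (auto simp: algebra_simps)
    then show ?thesis by blast
  qed
  moreover have "p = 1 \<or> p = - 1" if "quiddity_solution (a # ys @ [b])" for a b
    using that unfolding quiddity_solution_iff_mat2 M by (auto simp: minus_equation_iff)
  ultimately show ?thesis
    by (auto simp: pqrs)
qed

lemma cons_snoc_of_length_ge_2:
  assumes "length xs \<ge> 2"
  obtains a ys b where "xs = a # ys @ [b]"
  using assms by (cases xs; cases "tl xs" rule: rev_cases) auto

lemma tuple_sum_cons_snoc:
  "tuple_sum (a # xs @ [a']) (b # ys @ [b']) = (a + b') # xs @ [a' + b] @ ys"
  by (simp add: tuple_sum_def butlast_append)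

text \<open>In a sum the end entries of \<open>bs\<close> merge with those of \<open>as\<close>,
  which are arbitrary, so \<open>bs\<close> contributes only its interior \<open>ys\<close>. A
  decomposition is thus a cyclic factor \<open>ys\<close> that can be bordered to a solution. The
  bounds on \<open>xs\<close> and \<open>ys\<close> express \<open>length as \<ge> 3\<close> and
  \<open>length bs \<ge> 3\<close>.\<close>

lemma reducible_solution_iff:
  "reducible_solution cs \<longleftrightarrow> quiddity_solution cs \<and>
    (\<exists>xs ys. tuple_equiv cs (xs @ ys) \<and> length xs \<ge> 3 \<and> ys \<noteq> [] \<and>
      quiddity_matrix ys $ 1 $ 1 \<in> {1, - 1})"
  (is "_ \<longleftrightarrow> _ \<and> ?factor")
proof -
  have "?factor" if red: "reducible_solution cs"
  proof -
    obtain as bs where ab: "quiddity_solution bs" "length bs \<ge> 3" "length as \<ge> 3"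
        "tuple_equiv cs (tuple_sum as bs)"
      using red by (auto simp: reducible_solution_def)
    obtain a xs a' where as: "as = a # xs @ [a']"
      using ab(3) by (auto intro: cons_snoc_of_length_ge_2[of as])
    obtain b ys b' where bs: "bs = b # ys @ [b']"
      using ab(2) by (auto intro: cons_snoc_of_length_ge_2[of bs])
    have "quiddity_matrix ys $ 1 $ 1 \<in> {1, - 1}"
      using ab(1) ex_solution_extending_iff[of ys] unfolding bs by blast
    moreover have "tuple_equiv cs (((a + b') # xs @ [a' + b]) @ ys)"
      using ab(4) by (simp add: as bs tuple_sum_cons_snoc)
    moreover have "length ((a + b') # xs @ [a' + b]) \<ge> 3" "ys \<noteq> []"
      using ab(2,3) by (auto simp: as bs)
    ultimately show ?thesis by blast
  qed
  moreover have "reducible_solution cs" if sol: "quiddity_solution cs" and ?factor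
  proof -
    obtain zs ys where zy: "tuple_equiv cs (zs @ ys)" "length zs \<ge> 3" "ys \<noteq> []"
        "quiddity_matrix ys $ 1 $ 1 \<in> {1, - 1}"
      using \<open>?factor\<close> by blast
    obtain a b where ab: "quiddity_solution (a # ys @ [b])"
      using zy(4) ex_solution_extending_iff[of ys] by blast
    obtain x xs x' where zs: "zs = x # xs @ [x']"
      using zy(2) by (auto intro: cons_snoc_of_length_ge_2[of zs])
    \<comment> \<open>The corrections \<open>- b\<close> and \<open>- a\<close> cancel what the sum
      adds at the two junctions.\<close>
    have "tuple_equiv cs (tuple_sum ((x - b) # xs @ [x' - a]) (a # ys @ [b]))"
      using zy(1) by (simp add: tuple_sum_cons_snoc zs)
    moreover have "length (a # ys @ [b]) \<ge> 3" "length ((x - b) # xs @ [x' - a]) \<ge> 3"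
      using zy(2,3) by (auto simp: zs Suc_le_eq)
    moreover have "length (zs @ ys) = length cs"
      using zy(1) by (auto simp only: tuple_equiv_def length_rotate length_rev)
    then have "length cs \<ge> 3"
      using zy(2) by simp
    ultimately show ?thesis
      using sol ab unfolding reducible_solution_def by blast
  qed
  ultimately show ?thesis
    by (auto simp: reducible_solution_def)
qed

section \<open>Tuples of period three: shifts, prefixes and matrices\<close>

abbreviation cyc3 :: "'a \<Rightarrow> 'a \<Rightarrow> 'a \<Rightarrow> nat \<Rightarrow> 'a list" where
  "cyc3 x y z k \<equiv> concat (replicate k [x, y, z])"

lemma length_cyc3 [simp]: "length (cyc3 x y z k) = 3 * k"
  by (induction k) auto

lemma cyc3_snoc: "cyc3 x y z (Suc k) = cyc3 x y z k @ [x, y, z]"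
  by (induction k) auto

lemma cyc3_append_shift: "cyc3 x y z k @ [x] = x # cyc3 y z x k"
  by (induction k) auto

lemma rotate1_cyc3: "rotate1 (cyc3 x y z k) = cyc3 y z x k"
  using cyc3_append_shift[of _ x y z] by (cases k) auto

lemma rev_cyc3: "rev (cyc3 x y z k) = cyc3 z y x k"
proof (induction k)
  case (Suc k)
  then show ?case by (subst (2) cyc3_snoc) simp
qed simp

lemma rotate_cyc3:
  "rotate j (cyc3 x y z k) \<in> {cyc3 x y z k, cyc3 y z x k, cyc3 z x y k}"
  by (induction j) (auto simp: rotate1_cyc3)

lemma take_cyc3:
  assumes "q < k" "r < 3"
  shows "take (3 * q + r) (cyc3 x y z k) = cyc3 x y z q @ take r [x, y, z]"
  using assms(1)
proof (induction q arbitrary: k)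
  case 0
  then show ?case using assms(2) by (cases k) (auto simp: take_Cons')
next
  case (Suc q)
  then obtain k' where k: "k = Suc k'" "q < k'"
    by (cases k) auto
  \<comment> \<open>Three explicit successors let \<open>take\<close> peel off exactly one
    block.\<close>
  have e: "3 * Suc q + r = Suc (Suc (Suc (3 * q + r)))"
    by simp
  have "take (3 * Suc q + r) (cyc3 x y z k) = x # y # z # take (3 * q + r) (cyc3 x y z k')"
    unfolding e k(1) by (simp only: replicate_Suc concat.simps append.simps take_Suc_Cons)
  also have "\<dots> = cyc3 x y z (Suc q) @ take r [x, y, z]"
    by (simp only: Suc.IH[OF k(2)]) simp
  finally show ?case .
qed

text \<open>As the last two letters agree, reversal yields just another shift, and the equivalence
  class consists of the three shifts. It is closed under rotation, so the factor at the end can be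
  moved to the front and appears as a prefix of length \<open>p\<close>.\<close>

lemma reducible_cyc3_iff:
  fixes x y :: "'a::comm_ring_1"
  shows "reducible_solution (cyc3 x y y k) \<longleftrightarrow> quiddity_solution (cyc3 x y y k) \<and>
    (\<exists>w \<in> {cyc3 x y y k, cyc3 y y x k, cyc3 y x y k}. \<exists>p. 1 \<le> p \<and> p + 3 \<le> 3 * k \<and>
      quiddity_matrix (take p w) $ 1 $ 1 \<in> {1, - 1})"
  (is "_ \<longleftrightarrow> _ \<and> (\<exists>w \<in> ?W. ?P w)")
proof -
  have W: "rotate j w \<in> ?W" if "w \<in> ?W" for j w
    using that rotate_cyc3[of j k x y y] rotate_cyc3[of j k y y x] rotate_cyc3[of j k y x y]
    by auto
  have equiv: "tuple_equiv (cyc3 x y y k) w \<longleftrightarrow> w \<in> ?W" for w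
  proof
    assume "tuple_equiv (cyc3 x y y k) w"
    then show "w \<in> ?W"
      using W[of "cyc3 x y y k"] W[of "cyc3 y y x k"] by (auto simp: tuple_equiv_def rev_cyc3)
  next
    have "cyc3 x y y k = rotate 0 (cyc3 x y y k)" "cyc3 y y x k = rotate 1 (cyc3 x y y k)"
      "cyc3 y x y k = rotate 2 (cyc3 x y y k)"
      by (simp_all add: rotate1_cyc3 numeral_2_eq_2)
    then show "w \<in> ?W \<Longrightarrow> tuple_equiv (cyc3 x y y k) w"
      unfolding tuple_equiv_def by blast
  qed
  have len: "length w = 3 * k" if "w \<in> ?W" for w
    using that by auto
  have "(\<exists>w \<in> ?W. ?P w) \<longleftrightarrow>
    (\<exists>xs ys. xs @ ys \<in> ?W \<and> length xs \<ge> 3 \<and> ys \<noteq> [] \<and> quiddity_matrix ys $ 1 $ 1 \<in> {1, - 1})"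
    (is "_ \<longleftrightarrow> ?R")
  proof
    assume "\<exists>w \<in> ?W. ?P w"
    then obtain w p where wp: "w \<in> ?W" "1 \<le> p" "p + 3 \<le> 3 * k"
        "quiddity_matrix (take p w) $ 1 $ 1 \<in> {1, - 1}"
      by blast
    have "drop p w @ take p w = rotate p w"
      using wp(3) len[OF wp(1)] by (simp add: rotate_drop_take)
    then have "drop p w @ take p w \<in> ?W"
      using W[OF wp(1)] by metis
    moreover have "length (drop p w) \<ge> 3" "take p w \<noteq> []"
      using wp(2,3) len[OF wp(1)] by auto
    ultimately show ?R
      using wp(4) by blast
  next
    assume ?R
    then obtain xs ys where xy: "xs @ ys \<in> ?W" "length xs \<ge> 3" "ys \<noteq> []"
        "quiddity_matrix ys $ 1 $ 1 \<in> {1, - 1}"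
      by blast
    have "ys @ xs \<in> ?W"
      using W[OF xy(1), of "length xs"] by (simp only: rotate_append)
    moreover have "take (length ys) (ys @ xs) = ys"
      by simp
    moreover have "1 \<le> length ys" "length ys + 3 \<le> 3 * k"
      using xy(2,3) len[OF xy(1)] by (auto simp: Suc_le_eq)
    ultimately show "\<exists>w \<in> ?W. ?P w"
      using xy(4) by metis
  qed
  then show ?thesis
    by (simp only: reducible_solution_iff equiv)
qed

text \<open>For \<open>k = 1\<close> all three matrices are triangular because
  \<open>u * v = 1\<close>, and the last is even diagonal. The corner entry of one block is, up to
  sign, \<open>1 - v * v = v * (u - v)\<close>, so the geometric sum in the \<open>k\<close>-th
  power collapses without division.\<close>

lemma quiddity_matrix_cyc3:
  fixes u v :: "'a::comm_ring_1"
  assumes uv: "u * v = 1"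
  shows "quiddity_matrix (cyc3 u v v k) =
      mat2 ((- 1) ^ k * u ^ k) ((- 1) ^ k * v * (v ^ k - u ^ k)) 0 ((- 1) ^ k * v ^ k)"
    and "quiddity_matrix (cyc3 v v u k) =
      mat2 ((- 1) ^ k * u ^ k) 0 ((- 1) ^ k * v * (u ^ k - v ^ k)) ((- 1) ^ k * v ^ k)"
    and "quiddity_matrix (cyc3 v u v k) = mat2 ((- 1) ^ k * v ^ k) 0 0 ((- 1) ^ k * u ^ k)"
proof -
  have vu: "v * u = 1" "v * (u * x) = x" "u * (v * x) = x" for x
    using uv by (simp_all add: mult.commute flip: mult.assoc)
  show "quiddity_matrix (cyc3 u v v k) =
      mat2 ((- 1) ^ k * u ^ k) ((- 1) ^ k * v * (v ^ k - u ^ k)) 0 ((- 1) ^ k * v ^ k)"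
    by (induction k)
      (simp_all add: mat_1_eq_mat2 elem_matrix_eq_mat2 algebra_simps uv vu)
  show "quiddity_matrix (cyc3 v v u k) =
      mat2 ((- 1) ^ k * u ^ k) 0 ((- 1) ^ k * v * (u ^ k - v ^ k)) ((- 1) ^ k * v ^ k)"
    by (induction k)
      (simp_all add: mat_1_eq_mat2 elem_matrix_eq_mat2 algebra_simps uv vu)
  show "quiddity_matrix (cyc3 v u v k) = mat2 ((- 1) ^ k * v ^ k) 0 0 ((- 1) ^ k * u ^ k)"
    by (induction k)
      (simp_all add: mat_1_eq_mat2 elem_matrix_eq_mat2 algebra_simps uv vu)
qed

section \<open>Solutions and reducibility among the trinomial tuples\<close>

lemma sign_mult_in_pm_one_iff:
  fixes x :: "'a::comm_ring_1"
  shows "(- 1) ^ k * x \<in> {1, - 1} \<longleftrightarrow> x \<in> {1, - 1}"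
  by (cases "even k") (auto simp: minus_equation_iff)

lemma inverse_power_in_pm_one_iff:
  fixes u :: "'a::field"
  shows "inverse u ^ k \<in> {1, - 1} \<longleftrightarrow> u ^ k \<in> {1, - 1}"
  by (auto simp: power_inverse inverse_eq_iff_eq[of _ "- 1", simplified])

lemma quiddity_solution_trinomial_iff:
  fixes u :: "'a::field"
  assumes "u \<noteq> 0"
  shows "quiddity_solution (trinomial_tuple u k) \<longleftrightarrow> u ^ k \<in> {1, - 1}"
proof -
  \<comment> \<open>Equality of the two powers makes the diagonal scalar and kills the corner, a
    multiple of their difference.\<close>
  have "inverse u ^ k = u ^ k" if "u ^ k \<in> {1, - 1}"
    using that by (auto simp: power_inverse)
  moreover have "(- 1 :: 'a) ^ k = 1 \<or> (- 1 :: 'a) ^ k = - 1"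
    by (cases "even k") auto
  ultimately show ?thesis
    using assms
    by (auto simp: quiddity_solution_iff_mat2 trinomial_tuple_def quiddity_matrix_cyc3
      minus_equation_iff)
qed

text \<open>A prefix is \<open>q\<close> full blocks and \<open>r < 3\<close> letters of one of
  three shifts. Of the nine cases, eight have a zero entry or one excluded by minimality of
  \<open>k\<close>; only the shift \<open>v, v, u\<close> with \<open>r = 2\<close> can give a
  decomposition.\<close>

lemma reducible_trinomial_iff:
  fixes u :: "'a::field"
  assumes u: "u \<noteq> 0" and uk: "u ^ k \<in> {1, - 1}"
    and min: "\<And>j. 0 < j \<Longrightarrow> j < k \<Longrightarrow> u ^ j \<notin> {1, - 1}"
  shows "reducible_solution (trinomial_tuple u k) \<longleftrightarrow>
    (\<exists>l. 0 < l \<and> l < k \<and> u ^ l - inverse u ^ l \<in> {u, - u})"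
proof -
  define v where "v = inverse u"
  have uv: "u * v = 1"
    using u by (simp add: v_def)
  have vu: "v * u = 1" "v * (u * x) = x" "u * (v * x) = x" for x
    using uv by (simp_all add: mult.commute flip: mult.assoc)
  have minv: "v ^ j \<notin> {1, - 1}" if "0 < j" "j < k" for j
    unfolding v_def inverse_power_in_pm_one_iff by (rule min[OF that])
  have r_cases: "r = 0 \<or> r = 1 \<or> r = 2" if "r < 3" for r :: nat
    using that by auto
  have q_less: "q < k" if "3 * q + r + 3 \<le> 3 * k" for q r
    using that by auto
  note entry_simps = quiddity_matrix_append quiddity_matrix_cyc3[OF uv]
    elem_matrix_eq_mat2 mat_1_eq_mat2 take_Cons' numeral_2_eq_2
  have uvv: "quiddity_matrix (take (3 * q + r) (cyc3 u v v k)) $ 1 $ 1 \<notin> {1, - 1}"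
    if p: "1 \<le> 3 * q + r" "3 * q + r + 3 \<le> 3 * k" "r < 3" for q r
  proof -
    \<comment> \<open>The zero for \<open>r = 2\<close> is the factor \<open>v * u - 1\<close> in
      the product of two elementary matrices.\<close>
    have "quiddity_matrix (take (3 * q + r) (cyc3 u v v k)) $ 1 $ 1 =
        (- 1) ^ q * (if r = 0 then u ^ q else if r = 1 then u ^ Suc q else 0)"
      unfolding take_cyc3[OF q_less[OF p(2)] p(3)]
      using r_cases[OF p(3)] by (auto simp: entry_simps uv vu)
    \<comment> \<open>For \<open>r = 0\<close> the prefix being nonempty gives \<open>q > 0\<close>;
      for \<open>r = 1\<close> the three letters left over give \<open>Suc q < k\<close>. So
      \<open>min\<close> applies in both cases.\<close>
    then show ?thesis
      using r_cases[OF p(3)] p min[of q] min[of "Suc q"]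
      by (auto simp only: sign_mult_in_pm_one_iff split: if_splits) auto
  qed
  have vuv: "quiddity_matrix (take (3 * q + r) (cyc3 v u v k)) $ 1 $ 1 \<notin> {1, - 1}"
    if p: "1 \<le> 3 * q + r" "3 * q + r + 3 \<le> 3 * k" "r < 3" for q r
  proof -
    have "quiddity_matrix (take (3 * q + r) (cyc3 v u v k)) $ 1 $ 1 =
        (- 1) ^ q * (if r = 0 then v ^ q else if r = 1 then v ^ Suc q else 0)"
      unfolding take_cyc3[OF q_less[OF p(2)] p(3)]
      using r_cases[OF p(3)] by (auto simp: entry_simps uv vu)
    then show ?thesis
      using r_cases[OF p(3)] p minv[of q] minv[of "Suc q"]
      by (auto simp only: sign_mult_in_pm_one_iff split: if_splits) auto
  qed
  have vvu: "quiddity_matrix (take (3 * q + r) (cyc3 v v u k)) $ 1 $ 1 \<in> {1, - 1} \<longleftrightarrow>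
      r = 2 \<and> u ^ Suc q - v ^ Suc q \<in> {u, - u}"
    if p: "1 \<le> 3 * q + r" "3 * q + r + 3 \<le> 3 * k" "r < 3" for q r
  proof -
    have eq: "quiddity_matrix (take (3 * q + r) (cyc3 v v u k)) $ 1 $ 1 =
        (- 1) ^ q * (if r = 0 then u ^ q else if r = 1 then v ^ Suc q else v ^ Suc (Suc q) - u ^ q)"
      unfolding take_cyc3[OF q_less[OF p(2)] p(3)]
      using r_cases[OF p(3)] by (auto simp: entry_simps algebra_simps uv vu)
    \<comment> \<open>Multiplying the entry by \<open>- u\<close> balances the exponents, which
      prepares the symmetry between \<open>l\<close> and \<open>k - l\<close>.\<close>
    have "u ^ Suc q - v ^ Suc q = u * (- (v ^ Suc (Suc q) - u ^ q))"
      by (simp add: algebra_simps vu)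
    moreover have "u * (- x) \<in> {u, - u} \<longleftrightarrow> x \<in> {1, - 1}" for x
      using u mult_cancel_left[of u "- x" 1] mult_cancel_left[of u "- x" "- 1"]
      by (simp del: mult_minus_left mult_minus_right add: mult_minus1_right)
        (auto simp: minus_equation_iff)
    ultimately have "u ^ Suc q - v ^ Suc q \<in> {u, - u} \<longleftrightarrow> v ^ Suc (Suc q) - u ^ q \<in> {1, - 1}"
      by (simp only:)
    then show ?thesis
      using r_cases[OF p(3)] p min[of q] minv[of "Suc q"]
      unfolding eq sign_mult_in_pm_one_iff by auto
  qed
  have "reducible_solution (trinomial_tuple u k) \<longleftrightarrow>
      (\<exists>w \<in> {cyc3 u v v k, cyc3 v v u k, cyc3 v u v k}. \<exists>p. 1 \<le> p \<and> p + 3 \<le> 3 * k \<and>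
        quiddity_matrix (take p w) $ 1 $ 1 \<in> {1, - 1})"
    using quiddity_solution_trinomial_iff[OF u, of k] uk
    by (simp only: trinomial_tuple_def reducible_cyc3_iff simp_thms flip: v_def)
  also have "\<dots> \<longleftrightarrow>
      (\<exists>w \<in> {cyc3 u v v k, cyc3 v v u k, cyc3 v u v k}. \<exists>q r. r < 3 \<and> 1 \<le> 3 * q + r \<and>
        3 * q + r + 3 \<le> 3 * k \<and> quiddity_matrix (take (3 * q + r) w) $ 1 $ 1 \<in> {1, - 1})"
    by (metis mod_less_divisor mult_div_mod_eq zero_less_numeral)
  also have "\<dots> \<longleftrightarrow> (\<exists>q r. r < 3 \<and> 1 \<le> 3 * q + r \<and> 3 * q + r + 3 \<le> 3 * k \<and>
      r = 2 \<and> u ^ Suc q - v ^ Suc q \<in> {u, - u})"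
    using uvv vuv vvu by blast
  \<comment> \<open>With \<open>r = 2\<close> the bound reads \<open>3 * q + 5 \<le> 3 * k\<close>,
    that is, \<open>Suc q < k\<close>.\<close>
  also have "\<dots> \<longleftrightarrow> (\<exists>q. Suc q < k \<and> u ^ Suc q - v ^ Suc q \<in> {u, - u})"
    by (intro iff_exI) auto
  also have "\<dots> \<longleftrightarrow> (\<exists>l. 0 < l \<and> l < k \<and> u ^ l - v ^ l \<in> {u, - u})"
    by (metis Suc_pred zero_less_Suc)
  finally show ?thesis
    unfolding v_def .
qed

section \<open>The order of \<open>u\<close> and the least exponent with power \<plusminus>1\<close>

lemma finite_field_unit_order:
  fixes u :: "'a::{field, finite}"
  assumes "u \<noteq> 0"
  shows "unit_order u \<ge> 1" "u ^ unit_order u = 1"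
    and "\<And>n. u ^ n = 1 \<longleftrightarrow> unit_order u dvd n"
proof -
  \<comment> \<open>Pigeonhole: infinitely many exponents, finitely many powers. Two equal powers
    then give an exponent that witnesses the \<open>LEAST\<close> in
    \<open>unit_order\<close>.\<close>
  have "\<not> inj (\<lambda>n. u ^ n)"
    using finite_imageD[of "\<lambda>n. u ^ n" UNIV] by auto
  then obtain i j where "u ^ i = u ^ j" "i \<noteq> j"
    by (auto simp: inj_def)
  then obtain i j where ij: "u ^ i = u ^ j" "i < j"
    by (metis linorder_neq_iff)
  then have "u ^ (j - i) = 1"
    using assms by (simp add: power_diff)
  then have ex: "j - i \<ge> 1 \<and> u ^ (j - i) = 1"
    using ij(2) by simp
  have "unit_order u \<ge> 1 \<and> u ^ unit_order u = 1"
    unfolding unit_order_def by (rule LeastI[of _ "j - i"]) (rule ex)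
  then show ord: "unit_order u \<ge> 1" "u ^ unit_order u = 1"
    by simp_all
  show "u ^ n = 1 \<longleftrightarrow> unit_order u dvd n" for n
  proof
    assume "u ^ n = 1"
    moreover have "u ^ n = (u ^ unit_order u) ^ (n div unit_order u) * u ^ (n mod unit_order u)"
      by (simp flip: power_mult power_add)
    ultimately have "u ^ (n mod unit_order u) = 1"
      using ord(2) by simp
    moreover have "n mod unit_order u < unit_order u"
      using ord(1) by simp
    ultimately have "\<not> n mod unit_order u \<ge> 1"
      using not_less_Least unfolding unit_order_def by blast
    then show "unit_order u dvd n"
      by (simp add: dvd_eq_mod_eq_0 not_le)
  next
    assume "unit_order u dvd n"
    then show "u ^ n = 1"
      using ord(2) by (auto simp: power_mult)
  qed
qed

text \<open>In a field \<open>u ^ k\<close> is \<plusminus>1 iff its square is 1, so iff the order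
  divides \<open>2 * k\<close>. An even order then contributes its half, while an odd one is coprime
  to 2 and must divide \<open>k\<close>. In characteristic two \<open>1\<close> and
  \<open>- 1\<close> coincide, so the order itself is the answer.\<close>

lemma Least_power_in_pm_one:
  fixes u :: "'a::{field, finite}"
  assumes u: "u \<noteq> 0"
  shows "(LEAST k. k \<ge> 1 \<and> u ^ k \<in> {1, - 1}) =
    (if CHAR('a) \<noteq> 2 \<and> even (unit_order u) then unit_order u div 2 else unit_order u)"
proof -
  note ord = finite_field_unit_order[OF u]
  have sq: "u ^ k \<in> {1, - 1} \<longleftrightarrow> u ^ (2 * k) = 1" for k
    by (simp add: power2_eq_1_iff power_mult mult.commute[of 2])
  show ?thesis
  proof (cases "CHAR('a) \<noteq> 2 \<and> even (unit_order u)")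
    case True
    then obtain h where h: "unit_order u = 2 * h"
      by auto
    have "(LEAST k. k \<ge> 1 \<and> u ^ k \<in> {1, - 1}) = h"
      using ord(1) unfolding sq ord(3) h
      by (intro Least_equality) (auto dest: dvd_imp_le)
    then show ?thesis
      using True h by simp
  next
    case False
    have "u ^ k \<in> {1, - 1} \<longleftrightarrow> unit_order u dvd k" for k
    proof (cases "CHAR('a) = 2")
      case True
      then have "(- 1 :: 'a) = 1"
        using of_nat_CHAR[where 'a = 'a] by (simp add: minus_equation_iff eq_neg_iff_add_eq_0)
      then show ?thesis
        by (simp only: ord(3) insert_absorb2 singleton_iff)
    next
      case char: False
      then have "coprime (unit_order u) 2"
        using False by simp
      then show ?thesis
        by (simp only: sq ord(3) coprime_dvd_mult_right_iff)
    qed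
    then have "(LEAST k. k \<ge> 1 \<and> u ^ k \<in> {1, - 1}) = unit_order u"
      using ord(1) by (intro Least_equality) (auto dest: dvd_imp_le)
    then show ?thesis
      by (simp only: if_not_P[OF False])
  qed
qed

section \<open>Reflection of exponents, size and irreducibility\<close>

lemma power_diff_inverse_power_reflect:
  fixes u :: "'a::field"
  assumes "u ^ k \<in> {1, - 1}" "l \<le> k" "u \<noteq> 0"
  shows "u ^ (k - l) - inverse u ^ (k - l) \<in> {u, - u} \<longleftrightarrow> u ^ l - inverse u ^ l \<in> {u, - u}"
proof -
  \<comment> \<open>Being \<plusminus>1, \<open>u ^ k\<close> is its own inverse, so the reflection
    swaps the two powers up to one common sign.\<close>
  have "u ^ (k - l) = u ^ k * inverse u ^ l" "inverse u ^ (k - l) = u ^ k * u ^ l"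
    using assms by (auto simp: power_diff power_inverse field_simps)
  then have "u ^ (k - l) - inverse u ^ (k - l) = - (u ^ k) * (u ^ l - inverse u ^ l)"
    by (simp add: algebra_simps)
  moreover have "- (u ^ k) * d \<in> {u, - u} \<longleftrightarrow> d \<in> {u, - u}" for d
    using assms(1) by (auto simp: minus_equation_iff)
  ultimately show ?thesis
    by metis
qed

theorem theorem6p2:
  fixes u :: "'a::{field, finite}" and m :: nat
  assumes u: "u \<noteq> 0"
    and m: "m = length (trinomial_minimal_solution u)"
  shows "(CHAR('a) = 2 \<longrightarrow> m = 3 * unit_order u) \<and>
    (CHAR('a) \<noteq> 2 \<and> even (unit_order u) \<longrightarrow> m = 3 * unit_order u div 2) \<and>
    (CHAR('a) \<noteq> 2 \<and> odd (unit_order u) \<longrightarrow> m = 3 * unit_order u) \<and>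
    (u \<notin> {1, -1} \<longrightarrow>
      (irreducible_solution (trinomial_minimal_solution u) \<longleftrightarrow>
        (\<forall>l\<in>{1..m div 6}.
           poly (monom 1 (2 * l) + monom 1 (l + 1) - 1) u \<noteq> 0 \<and>
           poly (monom 1 (2 * l) - monom 1 (l + 1) - 1) u \<noteq> 0)))"
proof -
  define k where "k = (LEAST k. k \<ge> 1 \<and> u ^ k \<in> {1, - 1})"
  define v where "v = inverse u"
  have sol: "trinomial_minimal_solution u = trinomial_tuple u k"
    by (simp only: trinomial_minimal_solution_def quiddity_solution_trinomial_iff[OF u] k_def)
  then have mk: "m = 3 * k"
    using m by (simp add: trinomial_tuple_def)
  have k_eq: "k = (if CHAR('a) \<noteq> 2 \<and> even (unit_order u) then unit_order u div 2 else unit_order u)"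
    unfolding k_def by (rule Least_power_in_pm_one[OF u])
  have "unit_order u \<ge> 1 \<and> u ^ unit_order u \<in> {1, - 1}"
    using finite_field_unit_order[OF u] by simp
  then have k: "k \<ge> 1" "u ^ k \<in> {1, - 1}"
    unfolding k_def by (metis (mono_tags, lifting) LeastI)+
  have min: "u ^ j \<notin> {1, - 1}" if "0 < j" "j < k" for j
    using that not_less_Least[of j "\<lambda>k. k \<ge> 1 \<and> u ^ k \<in> {1, - 1}"] unfolding k_def by auto
  have poly_iff: "poly (monom 1 (2 * l) + monom 1 (l + 1) - 1) u \<noteq> 0 \<and>
      poly (monom 1 (2 * l) - monom 1 (l + 1) - 1) u \<noteq> 0 \<longleftrightarrow> u ^ l - v ^ l \<notin> {u, - u}" for l
  proof -
    \<comment> \<open>Writing the constant 1 this way lets the nonzero factor \<open>u ^ l\<close>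
      split off both polynomial values.\<close>
    have "u ^ l * v ^ l = 1"
      using u by (simp add: v_def power_inverse)
    then have "poly (monom 1 (2 * l) + monom 1 (l + 1) - 1) u = u ^ l * (u ^ l - v ^ l + u)"
      "poly (monom 1 (2 * l) - monom 1 (l + 1) - 1) u = u ^ l * (u ^ l - v ^ l - u)"
      by (simp_all add: poly_monom algebra_simps mult_2_right power_add)
    then show ?thesis
      using u by (auto simp: eq_neg_iff_add_eq_0)
  qed
  have "irreducible_solution (trinomial_tuple u k) \<longleftrightarrow>
      (\<forall>l\<in>{1..m div 6}. u ^ l - v ^ l \<notin> {u, - u})" if "u \<notin> {1, - 1}"
  proof -
    have "k \<noteq> 1"
      using k(2) that by auto
    have "irreducible_solution (trinomial_tuple u k) \<longleftrightarrow>
        \<not> (\<exists>l. 0 < l \<and> l < k \<and> u ^ l - v ^ l \<in> {u, - u})"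
      using k quiddity_solution_trinomial_iff[OF u, of k] reducible_trinomial_iff[OF u k(2) min]
      by (simp add: irreducible_solution_def v_def trinomial_tuple_def)
    also have "(\<exists>l. 0 < l \<and> l < k \<and> u ^ l - v ^ l \<in> {u, - u}) \<longleftrightarrow>
        (\<exists>l\<in>{1..m div 6}. u ^ l - v ^ l \<in> {u, - u})"
    proof
      assume "\<exists>l. 0 < l \<and> l < k \<and> u ^ l - v ^ l \<in> {u, - u}"
      then obtain l where l: "0 < l" "l < k" "u ^ l - v ^ l \<in> {u, - u}"
        by blast
      have "u ^ (k - l) - v ^ (k - l) \<in> {u, - u}"
        using l k(2) u power_diff_inverse_power_reflect[of u k l] by (simp add: v_def)
      \<comment> \<open>As \<open>m = 3 * k\<close>, the bound \<open>m div 6\<close> is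
        \<open>k div 2\<close>, and the smaller of \<open>l\<close> and \<open>k - l\<close> does
        not exceed it.\<close>
      moreover have "l \<in> {1..m div 6} \<or> k - l \<in> {1..m div 6}"
        using l(1,2) mk by auto
      ultimately show "\<exists>l\<in>{1..m div 6}. u ^ l - v ^ l \<in> {u, - u}"
        using l(3) by blast
    next
      assume "\<exists>l\<in>{1..m div 6}. u ^ l - v ^ l \<in> {u, - u}"
      moreover have "0 < l \<and> l < k" if "l \<in> {1..m div 6}" for l
        using that mk by auto
      ultimately show "\<exists>l. 0 < l \<and> l < k \<and> u ^ l - v ^ l \<in> {u, - u}"
        by blast
    qed
    finally show ?thesis
      by blast
  qed
  \<comment> \<open>For even order, \<open>3 * (unit_order u div 2)\<close> agrees with
    \<open>3 * unit_order u div 2\<close>, where the division comes last.\<close>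
  then show ?thesis
    unfolding sol poly_iff using mk k_eq by auto
qed

end
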